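(* Let $n\ge1$ be an integer and $\alpha\ge0$. The class $\mathcal{W}_{\mathcal{H}_n^0}(\alpha)$ is closed under convex combinations: if $f_1,\dots,f_m\in\mathcal{W}_{\mathcal{H}_n^0}(\alpha)$ and $t_1,\dots,t_m\in[0,1]$ satisfy $\sum_{s=1}^m t_s=1$, then $\sum_{s=1}^m t_sf_s\in\mathcal{W}_{\mathcal{H}_n^0}(\alpha)$.
   Context: $\mathbb{P}\Delta(0;1)=\{z=(z_1,\dots,z_n)\in\mathbb{C}^n: |z_i|<1,\ i=1,\dots,n\}$ is the unit polydisk. $\mathcal{H}_n^0$ is the class of complex-valued pluriharmonic functions $f$ in $\mathbb{P}\Delta(0;1)$ with $f(0)=0$, $\frac{\partial f}{\partial z_j}(0)=1$ and $\frac{\partial f}{\partial\overline{z}_j}(0)=0$ for $j=1,\dots,n$; every such $f$ is written $f=h+\overline{g}$ with $h,g$ holomorphic in $\mathbb{P}\Delta(0;1)$ and $h(0)=g(0)=0$. For $\alpha\ge0$, $\mathcal{W}_{\mathcal{H}_n^0}(\alpha)$ is the class of all $f=h+\overline{g}\in\mathcal{H}_n^0$ such that for all $z\in\mathbb{P}\Delta(0;1)$ and all $j,k,l\in\{1,\dots,n\}$, $$\Re\left(\frac{\partial h(z)}{\partial z_k}+\alpha z_l\frac{\partial^2h(z)}{\partial z_j\partial z_k}\right)>\left|\frac{\partial g(z)}{\partial z_k}+\alpha z_l\frac{\partial^2g(z)}{\partial z_j\partial z_k}\right|.$$ *)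

theory Defs
  imports "HOL-Analysis.Analysis"
begin

definition unit_polydisk :: "(complex ^ 'n) set" where
  "unit_polydisk = {z. \<forall>i. cmod (z $ i) < 1}"

(* Partial derivatives of f in the real coordinates x_j, y_j of z_j = x_j + i y_j. *)

definition partial_x :: "'n::finite \<Rightarrow> (complex ^ 'n \<Rightarrow> complex) \<Rightarrow> complex ^ 'n \<Rightarrow> complex" where
  "partial_x j f z = vector_derivative (\<lambda>t::real. f (z + axis j (of_real t))) (at 0)"

definition partial_y :: "'n::finite \<Rightarrow> (complex ^ 'n \<Rightarrow> complex) \<Rightarrow> complex ^ 'n \<Rightarrow> complex" where
  "partial_y j f z = vector_derivative (\<lambda>t::real. f (z + axis j (\<i> * of_real t))) (at 0)"

(* The Wirtinger operators; on holomorphic functions partial_z is the usual complex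
   partial derivative, so it also serves for the holomorphic parts h and g below. *)

definition partial_z :: "'n::finite \<Rightarrow> (complex ^ 'n \<Rightarrow> complex) \<Rightarrow> complex ^ 'n \<Rightarrow> complex" where
  "partial_z j f z = (partial_x j f z - \<i> * partial_y j f z) / 2"

definition partial_zbar :: "'n::finite \<Rightarrow> (complex ^ 'n \<Rightarrow> complex) \<Rightarrow> complex ^ 'n \<Rightarrow> complex" where
  "partial_zbar j f z = (partial_x j f z + \<i> * partial_y j f z) / 2"

(* Holomorphy in several variables: a complex-linear (Frechet) derivative at every point.
   Like the two notions after it, this is meant for open U. *)

definition holomorphic_several_on ::
    "(complex ^ 'n::finite \<Rightarrow> complex) \<Rightarrow> (complex ^ 'n) set \<Rightarrow> bool" where
  "holomorphic_several_on f U \<longleftrightarrow>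
     (\<forall>z\<in>U. \<exists>D. (f has_derivative D) (at z) \<and> (\<forall>c v. D (c *s v) = c * D v))"

definition C2_on ::
    "('a::real_normed_vector \<Rightarrow> 'b::real_normed_vector) \<Rightarrow> 'a set \<Rightarrow> bool" where
  "C2_on f U \<longleftrightarrow>
     (\<exists>(D1 :: 'a \<Rightarrow> 'a \<Rightarrow>\<^sub>L 'b) (D2 :: 'a \<Rightarrow> 'a \<Rightarrow>\<^sub>L ('a \<Rightarrow>\<^sub>L 'b)).
        (\<forall>x\<in>U. (f has_derivative blinfun_apply (D1 x)) (at x)) \<and>
        (\<forall>x\<in>U. (D1 has_derivative blinfun_apply (D2 x)) (at x)) \<and>
        continuous_on U D2)"

definition pluriharmonic_on ::
    "(complex ^ 'n::finite \<Rightarrow> complex) \<Rightarrow> (complex ^ 'n) set \<Rightarrow> bool" where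
  "pluriharmonic_on f U \<longleftrightarrow>
     C2_on f U \<and> (\<forall>z\<in>U. \<forall>j k. partial_z j (partial_zbar k f) z = 0)"

(* Functions on the polydisk are represented by total functions on C^n whose values
   elsewhere are irrelevant: the polydisk is open, so membership in either class depends
   only on the restriction. *)

definition H_class :: "(complex ^ 'n::finite \<Rightarrow> complex) set" where
  "H_class = {f. pluriharmonic_on f unit_polydisk \<and> f 0 = 0 \<and>
                 (\<forall>j. partial_z j f 0 = 1) \<and> (\<forall>j. partial_zbar j f 0 = 0)}"

(* The normalisation h 0 = g 0 = 0 determines h and g uniquely on the polydisk, so the
   existential quantifier only names the canonical decomposition of f. *)

definition W_class :: "real \<Rightarrow> (complex ^ 'n::finite \<Rightarrow> complex) set" where
  "W_class \<alpha> = {f. f \<in> H_class \<and>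
     (\<exists>h g. holomorphic_several_on h unit_polydisk \<and> holomorphic_several_on g unit_polydisk \<and>
        h 0 = 0 \<and> g 0 = 0 \<and>
        (\<forall>z\<in>unit_polydisk. f z = h z + cnj (g z)) \<and>
        (\<forall>z\<in>unit_polydisk. \<forall>j k l.
           Re (partial_z k h z + of_real \<alpha> * z $ l * partial_z j (partial_z k h) z)
           > cmod (partial_z k g z + of_real \<alpha> * z $ l * partial_z j (partial_z k g) z)))}"

end

theory Submission
  imports Defs
begin

text \<open>
  The conditions defining the class are linear in \<open>f\<close>, with two exceptions.  The normalisation
  \<open>\<partial>f/\<partial>z\<^sub>j(0) = 1\<close> is affine, and is preserved because the weights add up to \<open>1\<close>.  The strict
  inequality \<open>Re A > |B|\<close>, in which \<open>A\<close> and \<open>B\<close> depend linearly on \<open>h\<close> and \<open>g\<close>, survives convex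
  combinations by the triangle inequality, because at least one weight is positive.  So if
  \<open>f\<^sub>s = h\<^sub>s + cnj g\<^sub>s\<close>, the combination \<open>\<Sum> t\<^sub>s f\<^sub>s\<close> has the holomorphic parts \<open>\<Sum> t\<^sub>s h\<^sub>s\<close> and
  \<open>\<Sum> t\<^sub>s g\<^sub>s\<close>; conjugation respects the sum because the weights are real.

  The linearity of the second-order operators is where regularity enters: a vector derivative is
  additive only where it exists, so the first-order partial derivatives of \<open>h\<^sub>s\<close> and \<open>g\<^sub>s\<close> have to
  be differentiable again.  This comes from \<open>f\<^sub>s\<close> and not from holomorphy: as a \<open>C\<^sup>2\<close> function \<open>f\<^sub>s\<close>
  has differentiable Wirtinger derivatives (\<open>C2_on_imp_wirtinger_differentiable\<close>), and these are
  the derivatives of the two holomorphic parts: \<open>\<partial>h/\<partial>z\<^sub>k = \<partial>f/\<partial>z\<^sub>k\<close>, and \<open>\<partial>g/\<partial>z\<^sub>k\<close> is the conjugate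
  of the derivative of \<open>f\<close> by the conjugate of \<open>z\<^sub>k\<close> (\<open>wirtinger_holomorphic_plus_cnj\<close>).
\<close>

section \<open>Wirtinger derivatives of real-differentiable functions\<close>

lemma has_derivative_imp_vector_derivative_along_line:
  fixes f :: "'a::real_normed_vector \<Rightarrow> 'b::real_normed_vector"
  assumes "(f has_derivative D) (at z)"
  shows "((\<lambda>t::real. f (z + t *\<^sub>R v)) has_vector_derivative D v) (at 0)"
proof -
  have line: "((\<lambda>t::real. z + t *\<^sub>R v) has_derivative (\<lambda>t. t *\<^sub>R v)) (at 0)"
    by (auto intro!: derivative_eq_intros)
  have "(f has_derivative D) (at (z + (0::real) *\<^sub>R v))"
    using assms by simp
  from has_derivative_compose[OF line this]
  have "((\<lambda>t::real. f (z + t *\<^sub>R v)) has_derivative (\<lambda>t. D (t *\<^sub>R v))) (at 0)" .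
  then show ?thesis
    using has_derivative_linear[OF assms]
    by (simp add: has_vector_derivative_def linear_scale)
qed

lemma axis_times_of_real: "axis j (c * complex_of_real t) = t *\<^sub>R axis j c"
  by (simp add: axis_def vec_eq_iff scaleR_conv_of_real[where 'a = complex] mult.commute)

lemma partial_x_eq:
  assumes "(f has_derivative D) (at z)"
  shows "partial_x j f z = D (axis j 1)"
  using has_derivative_imp_vector_derivative_along_line[OF assms, of "axis j 1"]
    axis_times_of_real[of j 1]
  unfolding partial_x_def by (simp add: vector_derivative_at)

lemma partial_y_eq:
  assumes "(f has_derivative D) (at z)"
  shows "partial_y j f z = D (axis j \<i>)"
  using has_derivative_imp_vector_derivative_along_line[OF assms, of "axis j \<i>"]
  unfolding partial_y_def by (simp add: vector_derivative_at axis_times_of_real)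

lemma wirtinger_eq:
  assumes "(f has_derivative D) (at z)"
  shows "partial_z j f z = (D (axis j 1) - \<i> * D (axis j \<i>)) / 2"
    and "partial_zbar j f z = (D (axis j 1) + \<i> * D (axis j \<i>)) / 2"
  by (simp_all add: partial_z_def partial_zbar_def partial_x_eq[OF assms] partial_y_eq[OF assms])

lemma wirtinger_linear_combination:
  assumes "\<And>s. s \<in> S \<Longrightarrow> f s differentiable at z"
  shows "partial_z j (\<lambda>w. \<Sum>s\<in>S. c s * f s w) z = (\<Sum>s\<in>S. c s * partial_z j (f s) z)"
    and "partial_zbar j (\<lambda>w. \<Sum>s\<in>S. c s * f s w) z = (\<Sum>s\<in>S. c s * partial_zbar j (f s) z)"
proof -
  obtain D where D: "\<And>s. s \<in> S \<Longrightarrow> (f s has_derivative D s) (at z)"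
    using assms unfolding differentiable_def by metis
  have sum: "((\<lambda>w. \<Sum>s\<in>S. c s * f s w) has_derivative (\<lambda>v. \<Sum>s\<in>S. c s * D s v)) (at z)"
    by (intro has_derivative_sum has_derivative_mult_right D)
  show "partial_z j (\<lambda>w. \<Sum>s\<in>S. c s * f s w) z = (\<Sum>s\<in>S. c s * partial_z j (f s) z)"
    by (simp add: wirtinger_eq[OF sum] wirtinger_eq[OF D] sum_distrib_left
        sum_divide_distrib sum_subtractf right_diff_distrib diff_divide_distrib mult.left_commute)
  show "partial_zbar j (\<lambda>w. \<Sum>s\<in>S. c s * f s w) z = (\<Sum>s\<in>S. c s * partial_zbar j (f s) z)"
    by (simp add: wirtinger_eq[OF sum] wirtinger_eq[OF D] sum_distrib_left
        sum_divide_distrib sum.distrib distrib_left add_divide_distrib mult.left_commute)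
qed

text \<open>
  Identities between derivatives are available only on the open set \<open>U\<close>, so a second-order
  derivative of one side can be replaced by that of the other only by locality.
\<close>

lemma wirtinger_cong_open:
  assumes "open U" "z \<in> U" "\<And>w. w \<in> U \<Longrightarrow> f w = g w"
  shows "partial_z j f z = partial_z j g z" and "partial_zbar j f z = partial_zbar j g z"
proof -
  have along: "vector_derivative (\<lambda>t::real. f (z + axis j (c * of_real t))) (at 0)
      = vector_derivative (\<lambda>t::real. g (z + axis j (c * of_real t))) (at 0)" for c
  proof (rule vector_derivative_cong_eq)
    have "((\<lambda>t::real. z + t *\<^sub>R axis j c) \<longlongrightarrow> z + 0 *\<^sub>R axis j c) (nhds 0)"
      by (intro tendsto_intros filterlim_ident)
    then have "((\<lambda>t::real. z + axis j (c * of_real t)) \<longlongrightarrow> z) (nhds 0)"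
      by (simp add: axis_times_of_real)
    then have "\<forall>\<^sub>F t in nhds (0::real). z + axis j (c * of_real t) \<in> U"
      using assms(1,2) by (rule topological_tendstoD)
    then show "\<forall>\<^sub>F t in nhds (0::real). t \<in> UNIV \<longrightarrow>
        f (z + axis j (c * of_real t)) = g (z + axis j (c * of_real t))"
      by eventually_elim (simp add: assms(3))
  qed simp_all
  have "partial_x j f z = partial_x j g z" "partial_y j f z = partial_y j g z"
    using along[of 1] along[of \<i>] by (simp_all add: partial_x_def partial_y_def)
  then show "partial_z j f z = partial_z j g z" "partial_zbar j f z = partial_zbar j g z"
    by (simp_all add: partial_z_def partial_zbar_def)
qed

section \<open>Twice continuously differentiable functions\<close>

lemma C2_on_imp_differentiable:
  assumes "C2_on f U" "z \<in> U"
  shows "f differentiable at z"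
  using assms unfolding C2_on_def differentiable_def by blast

lemma C2_on_imp_wirtinger_differentiable:
  fixes f :: "complex ^ 'n::finite \<Rightarrow> complex"
  assumes "C2_on f U" "open U" "z \<in> U"
  shows "partial_z k f differentiable at z" and "partial_zbar k f differentiable at z"
proof -
  obtain D1 :: "complex ^ 'n \<Rightarrow> (complex ^ 'n) \<Rightarrow>\<^sub>L complex" and D2
    where D1: "\<And>x. x \<in> U \<Longrightarrow> (f has_derivative blinfun_apply (D1 x)) (at x)"
      and D2: "\<And>x. x \<in> U \<Longrightarrow> (D1 has_derivative blinfun_apply (D2 x)) (at x)"
    using assms(1) unfolding C2_on_def by metis
  have apply_diff: "(\<lambda>x. blinfun_apply (D1 x) v) differentiable at z" for v
    using bounded_linear.has_derivative[OF blinfun.bounded_linear_left D2[OF assms(3)], of v]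
    unfolding differentiable_def by blast
  have "(\<lambda>x. (blinfun_apply (D1 x) (axis k 1) - \<i> * blinfun_apply (D1 x) (axis k \<i>)) * (1/2))
      differentiable at z"
    by (intro differentiable_mult differentiable_diff differentiable_const apply_diff)
  moreover have "partial_z k f x
      = (blinfun_apply (D1 x) (axis k 1) - \<i> * blinfun_apply (D1 x) (axis k \<i>)) * (1/2)"
    if "x \<in> U" for x
    by (simp add: wirtinger_eq[OF D1[OF that]])
  ultimately show "partial_z k f differentiable at z"
    using assms(2,3) has_derivative_transform_within_open
    unfolding differentiable_def by (metis (no_types, lifting))
  have "(\<lambda>x. (blinfun_apply (D1 x) (axis k 1) + \<i> * blinfun_apply (D1 x) (axis k \<i>)) * (1/2))
      differentiable at z"
    by (intro differentiable_mult differentiable_add differentiable_const apply_diff)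
  moreover have "partial_zbar k f x
      = (blinfun_apply (D1 x) (axis k 1) + \<i> * blinfun_apply (D1 x) (axis k \<i>)) * (1/2)"
    if "x \<in> U" for x
    by (simp add: wirtinger_eq[OF D1[OF that]])
  ultimately show "partial_zbar k f differentiable at z"
    using assms(2,3) has_derivative_transform_within_open
    unfolding differentiable_def by (metis (no_types, lifting))
qed

lemma blinfun_apply_linear_combination:
  "blinfun_apply (\<Sum>s\<in>S. t s *\<^sub>R D s) = (\<lambda>v. \<Sum>s\<in>S. t s *\<^sub>R blinfun_apply (D s) v)"
  by (simp add: fun_eq_iff blinfun.sum_left blinfun.scaleR_left)

lemma C2_on_linear_combination:
  fixes f :: "'i \<Rightarrow> 'a::real_normed_vector \<Rightarrow> 'b::real_normed_vector"
  assumes "\<And>s. s \<in> S \<Longrightarrow> C2_on (f s) U"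
  shows "C2_on (\<lambda>x. \<Sum>s\<in>S. t s *\<^sub>R f s x) U"
proof -
  obtain D1 :: "'i \<Rightarrow> 'a \<Rightarrow> 'a \<Rightarrow>\<^sub>L 'b" and D2 :: "'i \<Rightarrow> 'a \<Rightarrow> 'a \<Rightarrow>\<^sub>L ('a \<Rightarrow>\<^sub>L 'b)"
    where D1: "\<And>s x. s \<in> S \<Longrightarrow> x \<in> U \<Longrightarrow> (f s has_derivative blinfun_apply (D1 s x)) (at x)"
      and D2: "\<And>s x. s \<in> S \<Longrightarrow> x \<in> U \<Longrightarrow> (D1 s has_derivative blinfun_apply (D2 s x)) (at x)"
      and cont: "\<And>s. s \<in> S \<Longrightarrow> continuous_on U (D2 s)"
    using assms unfolding C2_on_def by metis
  show ?thesis
    unfolding C2_on_def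
  proof (intro exI conjI ballI)
    fix x assume x: "x \<in> U"
    have "((\<lambda>x. \<Sum>s\<in>S. t s *\<^sub>R f s x) has_derivative
        (\<lambda>v. \<Sum>s\<in>S. t s *\<^sub>R blinfun_apply (D1 s x) v)) (at x)"
      by (intro has_derivative_sum has_derivative_scaleR_right D1 x)
    then show "((\<lambda>x. \<Sum>s\<in>S. t s *\<^sub>R f s x) has_derivative
        blinfun_apply (\<Sum>s\<in>S. t s *\<^sub>R D1 s x)) (at x)"
      by (simp only: blinfun_apply_linear_combination)
    have "((\<lambda>x. \<Sum>s\<in>S. t s *\<^sub>R D1 s x) has_derivative
        (\<lambda>v. \<Sum>s\<in>S. t s *\<^sub>R blinfun_apply (D2 s x) v)) (at x)"
      by (intro has_derivative_sum has_derivative_scaleR_right D2 x)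
    then show "((\<lambda>x. \<Sum>s\<in>S. t s *\<^sub>R D1 s x) has_derivative
        blinfun_apply (\<Sum>s\<in>S. t s *\<^sub>R D2 s x)) (at x)"
      by (simp only: blinfun_apply_linear_combination)
  next
    show "continuous_on U (\<lambda>x. \<Sum>s\<in>S. t s *\<^sub>R D2 s x)"
      by (intro continuous_intros cont)
  qed
qed

lemma pluriharmonic_on_linear_combination:
  fixes f :: "'i \<Rightarrow> complex ^ 'n::finite \<Rightarrow> complex"
  assumes "\<And>s. s \<in> S \<Longrightarrow> pluriharmonic_on (f s) U" "open U"
  shows "pluriharmonic_on (\<lambda>z. \<Sum>s\<in>S. of_real (t s) * f s z) U"
  unfolding pluriharmonic_on_def
proof (intro conjI ballI allI)
  have C2: "C2_on (f s) U" if "s \<in> S" for s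
    using assms(1)[OF that] by (simp add: pluriharmonic_on_def)
  show "C2_on (\<lambda>z. \<Sum>s\<in>S. of_real (t s) * f s z) U"
    using C2_on_linear_combination[OF C2, where t = t] by (simp add: scaleR_conv_of_real)
  fix z j k assume z: "z \<in> U"
  have "partial_z j (partial_zbar k (\<lambda>z. \<Sum>s\<in>S. of_real (t s) * f s z)) z
      = partial_z j (\<lambda>w. \<Sum>s\<in>S. of_real (t s) * partial_zbar k (f s) w) z"
    by (intro wirtinger_cong_open[OF assms(2) z] wirtinger_linear_combination
        C2_on_imp_differentiable[OF C2])
  also have "\<dots> = (\<Sum>s\<in>S. of_real (t s) * partial_z j (partial_zbar k (f s)) z)"
    by (intro wirtinger_linear_combination
        C2_on_imp_wirtinger_differentiable[OF C2 assms(2) z])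
  also have "\<dots> = 0"
    using assms(1) z by (simp add: pluriharmonic_on_def)
  finally show "partial_z j (partial_zbar k (\<lambda>z. \<Sum>s\<in>S. of_real (t s) * f s z)) z = 0" .
qed

section \<open>Holomorphic functions of several variables\<close>

lemma holomorphic_several_on_imp_differentiable:
  assumes "holomorphic_several_on f U" "z \<in> U"
  shows "f differentiable at z"
  using assms unfolding holomorphic_several_on_def differentiable_def by blast

lemma holomorphic_several_on_linear_combination:
  assumes "\<And>s. s \<in> S \<Longrightarrow> holomorphic_several_on (f s) U"
  shows "holomorphic_several_on (\<lambda>z. \<Sum>s\<in>S. c s * f s z) U"
  unfolding holomorphic_several_on_def
proof
  fix z assume z: "z \<in> U"
  have "\<forall>s\<in>S. \<exists>D. (f s has_derivative D) (at z) \<and> (\<forall>a v. D (a *s v) = a * D v)"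
    using assms z unfolding holomorphic_several_on_def by simp
  from bchoice[OF this] obtain D where
    D: "\<And>s. s \<in> S \<Longrightarrow> (f s has_derivative D s) (at z)"
    and lin: "\<And>s a v. s \<in> S \<Longrightarrow> D s (a *s v) = a * D s v"
    by auto
  have "((\<lambda>z. \<Sum>s\<in>S. c s * f s z) has_derivative (\<lambda>v. \<Sum>s\<in>S. c s * D s v)) (at z)"
    by (intro has_derivative_sum has_derivative_mult_right D)
  moreover have "(\<Sum>s\<in>S. c s * D s (a *s v)) = a * (\<Sum>s\<in>S. c s * D s v)" for a v
    by (simp add: lin sum_distrib_left mult.left_commute)
  ultimately show "\<exists>D. ((\<lambda>z. \<Sum>s\<in>S. c s * f s z) has_derivative D) (at z) \<and>
      (\<forall>c v. D (c *s v) = c * D v)"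
    by (intro exI[of _ "\<lambda>v. \<Sum>s\<in>S. c s * D s v"]) simp
qed

text \<open>
  The Cauchy--Riemann equations: complex linearity gives \<open>D (axis k \<i>) = \<i> * D (axis k 1)\<close> for
  both derivatives, so that \<open>partial_z\<close> kills the conjugate part and \<open>partial_zbar\<close> the
  holomorphic one.
\<close>

lemma wirtinger_holomorphic_plus_cnj:
  assumes "open U" "z \<in> U"
    and "holomorphic_several_on h U" "holomorphic_several_on g U"
    and "\<And>w. w \<in> U \<Longrightarrow> f w = h w + cnj (g w)"
  shows "partial_z k f z = partial_z k h z" and "partial_zbar k f z = cnj (partial_z k g z)"
proof -
  obtain H where H: "(h has_derivative H) (at z)" and linH: "\<And>c v. H (c *s v) = c * H v"
    using bspec[OF assms(3)[unfolded holomorphic_several_on_def] assms(2)] by (elim exE conjE) simp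
  obtain G where G: "(g has_derivative G) (at z)" and linG: "\<And>c v. G (c *s v) = c * G v"
    using bspec[OF assms(4)[unfolded holomorphic_several_on_def] assms(2)] by (elim exE conjE) simp
  have "\<i> *s axis k 1 = (axis k \<i> :: complex ^ 'a)"
    by (simp add: axis_def vec_eq_iff)
  then have I: "H (axis k \<i>) = \<i> * H (axis k 1)" "G (axis k \<i>) = \<i> * G (axis k 1)"
    using linH[of \<i> "axis k 1"] linG[of \<i> "axis k 1"] by simp_all
  have hg: "((\<lambda>w. h w + cnj (g w)) has_derivative (\<lambda>v. H v + cnj (G v))) (at z)"
    by (intro has_derivative_add H bounded_linear.has_derivative[OF bounded_linear_cnj G])
  have f: "(f has_derivative (\<lambda>v. H v + cnj (G v))) (at z)"
    by (rule has_derivative_transform_within_open[OF hg assms(1,2)]) (simp add: assms(5))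
  show "partial_z k f z = partial_z k h z" "partial_zbar k f z = cnj (partial_z k g z)"
    by (simp_all add: wirtinger_eq[OF f] wirtinger_eq[OF H] wirtinger_eq[OF G] I algebra_simps)
qed

text \<open>
  Regularity of the holomorphic parts is inherited from \<open>f\<close>: on \<open>U\<close> their partial derivatives
  are, up to conjugation, Wirtinger derivatives of the \<open>C\<^sup>2\<close> function \<open>f\<close>.
\<close>

lemma holomorphic_parts_partial_z_differentiable:
  assumes "open U" "z \<in> U" "C2_on f U"
    and "holomorphic_several_on h U" "holomorphic_several_on g U"
    and "\<And>w. w \<in> U \<Longrightarrow> f w = h w + cnj (g w)"
  shows "partial_z k h differentiable at z" and "partial_z k g differentiable at z"
proof -
  note parts = wirtinger_holomorphic_plus_cnj[OF assms(1) _ assms(4,5,6)]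
  obtain A B where A: "(partial_z k f has_derivative A) (at z)"
    and B: "(partial_zbar k f has_derivative B) (at z)"
    using C2_on_imp_wirtinger_differentiable[OF assms(3,1,2)] unfolding differentiable_def by metis
  have "(partial_z k h has_derivative A) (at z)"
    by (rule has_derivative_transform_within_open[OF A assms(1,2)]) (rule parts)
  then show "partial_z k h differentiable at z"
    unfolding differentiable_def by blast
  have "((\<lambda>w. cnj (partial_zbar k f w)) has_derivative (\<lambda>v. cnj (B v))) (at z)"
    by (rule bounded_linear.has_derivative[OF bounded_linear_cnj B])
  then have "(partial_z k g has_derivative (\<lambda>v. cnj (B v))) (at z)"
    by (rule has_derivative_transform_within_open[OF _ assms(1,2)]) (simp add: parts(2))
  then show "partial_z k g differentiable at z"
    unfolding differentiable_def by blast
qed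

lemma partial_z_partial_z_linear_combination:
  assumes "open U" "z \<in> U"
    and "\<And>s. s \<in> S \<Longrightarrow> holomorphic_several_on (h s) U"
    and "\<And>s. s \<in> S \<Longrightarrow> partial_z k (h s) differentiable at z"
  shows "partial_z j (partial_z k (\<lambda>w. \<Sum>s\<in>S. c s * h s w)) z
    = (\<Sum>s\<in>S. c s * partial_z j (partial_z k (h s)) z)"
proof -
  have "partial_z j (partial_z k (\<lambda>w. \<Sum>s\<in>S. c s * h s w)) z
      = partial_z j (\<lambda>w. \<Sum>s\<in>S. c s * partial_z k (h s) w) z"
    by (intro wirtinger_cong_open[OF assms(1,2)] wirtinger_linear_combination
        holomorphic_several_on_imp_differentiable[OF assms(3)])
  also have "\<dots> = (\<Sum>s\<in>S. c s * partial_z j (partial_z k (h s)) z)"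
    by (intro wirtinger_linear_combination assms(4))
  finally show ?thesis .
qed

section \<open>Convex combinations in the two classes\<close>

lemma open_unit_polydisk: "open (unit_polydisk :: (complex ^ 'n::finite) set)"
proof -
  have "unit_polydisk = (\<Inter>i. {z :: complex ^ 'n. cmod (z $ i) < 1})"
    by (auto simp: unit_polydisk_def)
  moreover have "open (\<Inter>i. {z :: complex ^ 'n. cmod (z $ i) < 1})"
    by (intro open_INT finite ballI open_Collect_less continuous_intros)
  ultimately show ?thesis
    by metis
qed

lemma zero_in_unit_polydisk: "0 \<in> unit_polydisk"
  by (simp add: unit_polydisk_def)

lemma H_class_convex_combination:
  fixes f :: "'i \<Rightarrow> complex ^ 'n::finite \<Rightarrow> complex"
  assumes f: "\<And>s. s \<in> S \<Longrightarrow> f s \<in> H_class" and t: "sum t S = (1::real)"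
  shows "(\<lambda>z. \<Sum>s\<in>S. of_real (t s) * f s z) \<in> H_class"
proof -
  have ph: "pluriharmonic_on (f s) unit_polydisk" if "s \<in> S" for s
    using f[OF that] by (simp add: H_class_def)
  have diff: "f s differentiable at 0" if "s \<in> S" for s
    using ph[OF that] C2_on_imp_differentiable[OF _ zero_in_unit_polydisk]
    by (auto simp: pluriharmonic_on_def)
  have "(\<Sum>s\<in>S. complex_of_real (t s)) = 1"
    using t by (metis of_real_1 of_real_sum)
  then show ?thesis
    using f pluriharmonic_on_linear_combination[OF ph open_unit_polydisk, where t = t]
      wirtinger_linear_combination[where f = f and c = "\<lambda>s. of_real (t s)", OF diff]
    by (simp add: H_class_def)
qed

lemma Re_greater_cmod_convex_combination:
  fixes a b :: "'i \<Rightarrow> complex" and t :: "'i \<Rightarrow> real"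
  assumes "finite S" "\<And>s. s \<in> S \<Longrightarrow> t s \<ge> 0" "sum t S = 1"
    and "\<And>s. s \<in> S \<Longrightarrow> Re (a s) > cmod (b s)"
  shows "Re (\<Sum>s\<in>S. of_real (t s) * a s) > cmod (\<Sum>s\<in>S. of_real (t s) * b s)"
proof -
  obtain r where r: "r \<in> S" "t r > 0"
    using assms(2,3) by (metis order_le_less sum.neutral zero_neq_one)
  have "cmod (\<Sum>s\<in>S. of_real (t s) * b s) \<le> (\<Sum>s\<in>S. cmod (of_real (t s) * b s))"
    by (rule norm_sum)
  also have "\<dots> = (\<Sum>s\<in>S. t s * cmod (b s))"
    by (rule sum.cong) (simp_all add: norm_mult assms(2))
  also have "\<dots> < (\<Sum>s\<in>S. t s * Re (a s))"
  proof (rule sum_strict_mono_ex1[OF assms(1)])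
    show "\<forall>s\<in>S. t s * cmod (b s) \<le> t s * Re (a s)"
      using assms(2,4) by (simp add: mult_left_mono less_imp_le)
    show "\<exists>s\<in>S. t s * cmod (b s) < t s * Re (a s)"
      using r assms(4) by (intro bexI[of _ r]) simp_all
  qed
  finally show ?thesis
    by simp
qed

theorem theorem3p6:
  fixes f :: "nat \<Rightarrow> complex ^ 'n::finite \<Rightarrow> complex"
    and t :: "nat \<Rightarrow> real" and m :: nat and \<alpha> :: real
  assumes "\<alpha> \<ge> 0"
    and "\<And>s. s \<in> {1..m} \<Longrightarrow> f s \<in> W_class \<alpha>"
    and "\<And>s. s \<in> {1..m} \<Longrightarrow> t s \<in> {0..1}"
    and "(\<Sum>s=1..m. t s) = 1"
  shows "(\<lambda>z. \<Sum>s=1..m. of_real (t s) * f s z) \<in> W_class \<alpha>"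
proof -
  let ?S = "{1..m}" and ?U = "unit_polydisk :: (complex ^ 'n) set"
  let ?T = "\<lambda>h j k l z. partial_z k h z + of_real \<alpha> * z $ l * partial_z j (partial_z k h) z"
  let ?comb = "\<lambda>h z. \<Sum>s\<in>?S. of_real (t s) * h s z"
  have fH: "f s \<in> H_class" if "s \<in> ?S" for s
    using assms(2)[OF that] by (simp add: W_class_def)
  then have C2: "C2_on (f s) ?U" if "s \<in> ?S" for s
    using that by (simp add: H_class_def pluriharmonic_on_def)
  define parts where "parts s h g \<longleftrightarrow> holomorphic_several_on h ?U \<and>
      holomorphic_several_on g ?U \<and> h 0 = 0 \<and> g 0 = 0 \<and>
      (\<forall>z\<in>?U. f s z = h z + cnj (g z)) \<and>
      (\<forall>z\<in>?U. \<forall>j k l. Re (?T h j k l z) > cmod (?T g j k l z))" for s h g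
  have "\<exists>h g. parts s h g" if "s \<in> ?S" for s
    using assms(2)[OF that] unfolding W_class_def parts_def by blast
  then obtain h g where parts: "\<And>s. s \<in> ?S \<Longrightarrow> parts s (h s) (g s)"
    by metis
  have hol: "holomorphic_several_on (h s) ?U" "holomorphic_several_on (g s) ?U"
    and zero: "h s 0 = 0" "g s 0 = 0" if "s \<in> ?S" for s
    using parts[OF that] by (simp_all add: parts_def)
  have eq: "f s z = h s z + cnj (g s z)"
    and ineq: "Re (?T (h s) j k l z) > cmod (?T (g s) j k l z)"
    if "s \<in> ?S" "z \<in> ?U" for s z j k l
    using parts[OF that(1)] that(2) by (simp_all add: parts_def)
  have diff: "partial_z k (h s) differentiable at z" "partial_z k (g s) differentiable at z"
    if "s \<in> ?S" "z \<in> ?U" for s z k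
    using holomorphic_parts_partial_z_differentiable[OF open_unit_polydisk that(2) C2 hol eq]
      that(1) by blast+
  have T_comb: "?T (?comb p) j k l z = (\<Sum>s\<in>?S. of_real (t s) * ?T (p s) j k l z)"
    if z: "z \<in> ?U" and p: "\<And>s. s \<in> ?S \<Longrightarrow> holomorphic_several_on (p s) ?U"
      "\<And>s. s \<in> ?S \<Longrightarrow> partial_z k (p s) differentiable at z" for p j k l z
  proof -
    have "partial_z k (?comb p) z = (\<Sum>s\<in>?S. of_real (t s) * partial_z k (p s) z)"
      by (intro wirtinger_linear_combination holomorphic_several_on_imp_differentiable[OF p(1) z])
    moreover have "partial_z j (partial_z k (?comb p)) z
        = (\<Sum>s\<in>?S. of_real (t s) * partial_z j (partial_z k (p s)) z)"
      by (intro partial_z_partial_z_linear_combination[OF open_unit_polydisk z] p)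
    ultimately show ?thesis
      by (simp only: sum_distrib_left sum.distrib distrib_left mult.left_commute)
  qed
  show ?thesis
    unfolding W_class_def
  proof (rule CollectI, rule conjI)
    show "?comb f \<in> H_class"
      by (rule H_class_convex_combination[OF fH assms(4)])
  next
    show "\<exists>h g. holomorphic_several_on h ?U \<and> holomorphic_several_on g ?U \<and>
        h 0 = 0 \<and> g 0 = 0 \<and> (\<forall>z\<in>?U. ?comb f z = h z + cnj (g z)) \<and>
        (\<forall>z\<in>?U. \<forall>j k l. Re (?T h j k l z) > cmod (?T g j k l z))"
    proof (rule exI[of _ "?comb h"], rule exI[of _ "?comb g"], intro conjI ballI allI)
      show "holomorphic_several_on (?comb h) ?U" "holomorphic_several_on (?comb g) ?U"
        by (intro holomorphic_several_on_linear_combination hol; assumption)+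
      show "?comb h 0 = 0" "?comb g 0 = 0"
        by (simp_all add: zero)
    next
      fix z assume "z \<in> ?U"
      then show "?comb f z = ?comb h z + cnj (?comb g z)"
        by (simp add: eq sum.distrib distrib_left)
    next
      fix z j k l assume z: "z \<in> ?U"
      have "cmod (\<Sum>s\<in>?S. of_real (t s) * ?T (g s) j k l z)
          < Re (\<Sum>s\<in>?S. of_real (t s) * ?T (h s) j k l z)"
        using assms(3,4) ineq[OF _ z] by (intro Re_greater_cmod_convex_combination) simp_all
      then show "cmod (?T (?comb g) j k l z) < Re (?T (?comb h) j k l z)"
        using T_comb[OF z hol(1) diff(1)[OF _ z]] T_comb[OF z hol(2) diff(2)[OF _ z]] by simp
    qed
  qed
qed

end
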